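(* Let $X\in\mathbb R^{n\times p}$ be fixed with rows $\mathbf x_i^{\rm T}$, and let $f$ be a fixed baseline density with $f(\cdot)>0$ on $\mathbb R$ such that, conditionally on $\mathbf x_i$, the independent responses $Y_i$ ($i=1,\dots,n$) have density $$f_{Y_i}(y_i\mid\mathbf x_i;\theta_i,\sigma)=\frac1\sigma f\!\left(\frac{y_i-\theta_i}{\sigma}\right),\qquad \sigma>0,\qquad \theta_i=g(\beta_0+\mathbf x_i^{\rm T}\boldsymbol\beta).$$ Let $l_n(\boldsymbol\theta,\sigma;\mathcal D)=\log\sigma-\frac1n\sum_{i=1}^n\log f\left((y_i-\theta_i)/\sigma\right)$ be the average negative log-likelihood, and write $\tilde l_n(\theta,\sigma;\mathcal D)=l_n(\theta\mathbf 1_n,\sigma;\mathcal D)$. Assume that, under the null model $\boldsymbol\beta=\mathbf 0$, there exists $\hat{\boldsymbol\tau}=(\hat\beta_0,\hat\sigma)$ with $g(\hat\beta_0)=\hat\theta^{\rm MLE}$ and $\hat\sigma=\hat\sigma^{\rm MLE}$, and that the Hessian satisfies $\nabla^2_{(\theta,\sigma)}\tilde l_n(\hat\theta^{\rm MLE},\hat\sigma;\mathcal D)\succ0$. Then PIC is finite-sample pivotal for $(\phi,g)=(\exp,\mathrm{id})$.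
   Context: $\mathcal D=(X,\mathbf y)$, where $\mathbf y$ is a realization of $(Y_1,\dots,Y_n)$. $(\hat\theta^{\rm MLE},\hat\sigma^{\rm MLE})$ denotes the maximum likelihood estimator under the null model, i.e. the minimizer of $(\theta,\sigma)\mapsto\tilde l_n(\theta,\sigma;\mathcal D)$ over $\mathbb R\times(0,\infty)$. PIC (pivotal information criterion): $\phi\left(l_n(\boldsymbol\theta,\sigma;\mathcal D)\right)+\lambda\,C(\boldsymbol\beta)$ with $\boldsymbol\theta=g(\beta_0\mathbf 1+X\boldsymbol\beta)$ ($g$ componentwise), where $C(\boldsymbol\beta)=\sum_{i=1}^p\rho(\beta_i)$ with $\rho:\mathbb R\to[0,\infty)$ even, nondecreasing on $\mathbb R^+$, and $\lim_{\epsilon\to0^+}C(\epsilon\boldsymbol\beta)/\epsilon=\|\boldsymbol\beta\|_1$. The zero-thresholding function of PIC's composite loss $L(\boldsymbol\beta,\beta_0,\sigma;\mathcal D)=\phi(l_n(g(\beta_0\mathbf 1+X\boldsymbol\beta),\sigma;\mathcal D))$ is $\lambda_0(\phi\circ l_n\circ g,\mathcal D)=\|\nabla_{\boldsymbol\beta}L(\mathbf 0,\hat\beta_0,\hat\sigma;\mathcal D)\|_\infty$. Finite-sample pivotal: for the given $n$, when $\mathbf Y_0$ is generated from the model with $\boldsymbol\beta=\mathbf 0$ and nuisance parameters $(\beta_0,\sigma)$, the distribution of the random variable $\Lambda=\lambda_0(\phi\circ l_n\circ g,(X,\mathbf Y_0))$ does not depend on $(\beta_0,\sigma)\in\mathbb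 R\times(0,\infty)$. The existence and Hessian assumptions on the MLE in the claim are understood to hold for almost every $\mathbf y$ under the null model. *)

theory Defs
  imports "HOL-Probability.Probability"
begin

definition linear_predictor :: "real^'p^'n \<Rightarrow> real \<Rightarrow> real^'p \<Rightarrow> real^'n" where
  "linear_predictor X \<beta>0 \<beta> = (\<chi> i. \<beta>0 + (X *v \<beta>) $ i)"

definition location :: "(real \<Rightarrow> real) \<Rightarrow> real^'p^'n \<Rightarrow> real \<Rightarrow> real^'p \<Rightarrow> real^'n" where
  "location g X \<beta>0 \<beta> = (\<chi> i. g (linear_predictor X \<beta>0 \<beta> $ i))"

definition response_density :: "(real \<Rightarrow> real) \<Rightarrow> real \<Rightarrow> real \<Rightarrow> real \<Rightarrow> real" where
  "response_density f \<theta> \<sigma> u = (1 / \<sigma>) * f ((u - \<theta>) / \<sigma>)"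

text \<open>Joint law of the independent responses, transported from the product space of
  functions \<open>'n \<Rightarrow> real\<close> to the vectors \<open>real^'n\<close>.\<close>

definition response_law ::
  "(real \<Rightarrow> real) \<Rightarrow> (real \<Rightarrow> real) \<Rightarrow> real^'p^'n \<Rightarrow> real \<Rightarrow> real^'p \<Rightarrow> real \<Rightarrow> (real^'n) measure" where
  "response_law g f X \<beta>0 \<beta> \<sigma> =
     distr (\<Pi>\<^sub>M i\<in>(UNIV :: 'n set).
              density lborel (\<lambda>u. ennreal (response_density f (location g X \<beta>0 \<beta> $ i) \<sigma> u)))
       borel (\<lambda>\<omega>. \<chi> i. \<omega> i)"

abbreviation null_law ::
  "(real \<Rightarrow> real) \<Rightarrow> (real \<Rightarrow> real) \<Rightarrow> real^'p^'n \<Rightarrow> real \<Rightarrow> real \<Rightarrow> (real^'n) measure" where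
  "null_law g f X \<beta>0 \<sigma> \<equiv> response_law g f X \<beta>0 0 \<sigma>"

definition avg_nll :: "(real \<Rightarrow> real) \<Rightarrow> real^'n \<Rightarrow> real \<Rightarrow> real^'n \<Rightarrow> real" where
  "avg_nll f \<theta> \<sigma> y =
     ln \<sigma> - (1 / real CARD('n)) * (\<Sum>i\<in>UNIV. ln (f ((y $ i - \<theta> $ i) / \<sigma>)))"

definition null_nll :: "(real \<Rightarrow> real) \<Rightarrow> real^'n \<Rightarrow> real \<times> real \<Rightarrow> real" where
  "null_nll f y = (\<lambda>(\<theta>, \<sigma>). avg_nll f (\<chi> i. \<theta>) \<sigma> y)"

definition is_null_mle :: "(real \<Rightarrow> real) \<Rightarrow> real^'n \<Rightarrow> real \<times> real \<Rightarrow> bool" where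
  "is_null_mle f y \<tau> \<longleftrightarrow> is_arg_min (null_nll f y) (\<lambda>(\<theta>, \<sigma>). 0 < \<sigma>) \<tau>"

text \<open>Only meaningful when the minimizer exists and is unique.\<close>

definition null_mle :: "(real \<Rightarrow> real) \<Rightarrow> real^'n \<Rightarrow> real \<times> real" where
  "null_mle f y = (THE \<tau>. is_null_mle f y \<tau>)"

definition is_nuisance_est ::
  "(real \<Rightarrow> real) \<Rightarrow> (real \<Rightarrow> real) \<Rightarrow> real^'n \<Rightarrow> real \<times> real \<Rightarrow> bool" where
  "is_nuisance_est g f y = (\<lambda>(\<beta>0, \<sigma>). g \<beta>0 = fst (null_mle f y) \<and> \<sigma> = snd (null_mle f y))"

text \<open>For non-injective \<open>g\<close> the intercept estimate is some fixed preimage of the location MLE.\<close>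

definition nuisance_est :: "(real \<Rightarrow> real) \<Rightarrow> (real \<Rightarrow> real) \<Rightarrow> real^'n \<Rightarrow> real \<times> real" where
  "nuisance_est g f y = (SOME \<tau>. is_nuisance_est g f y \<tau>)"

text \<open>The function has a second-order Frechet derivative at the point, and it is positive
  definite; \<open>H\<close> is the Hessian as a linear operator.\<close>

definition pos_def_Hessian_at :: "('a::real_inner \<Rightarrow> real) \<Rightarrow> 'a \<Rightarrow> bool" where
  "pos_def_Hessian_at F x \<longleftrightarrow>
     (\<exists>G H. (\<forall>\<^sub>F z in nhds x. GDERIV F z :> G z) \<and> (G has_derivative H) (at x) \<and>
            (\<forall>v. v \<noteq> 0 \<longrightarrow> 0 < inner v (H v)))"

definition gradient :: "('a::real_inner \<Rightarrow> real) \<Rightarrow> 'a \<Rightarrow> 'a" where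
  "gradient F x = (THE D. GDERIV F x :> D)"

definition composite_loss ::
  "(real \<Rightarrow> real) \<Rightarrow> (real \<Rightarrow> real) \<Rightarrow> (real \<Rightarrow> real) \<Rightarrow> real^'p^'n \<Rightarrow>
   real^'p \<Rightarrow> real \<Rightarrow> real \<Rightarrow> real^'n \<Rightarrow> real" where
  "composite_loss \<phi> g f X \<beta> \<beta>0 \<sigma> y = \<phi> (avg_nll f (location g X \<beta>0 \<beta>) \<sigma> y)"

definition null_profile_loss ::
  "(real \<Rightarrow> real) \<Rightarrow> (real \<Rightarrow> real) \<Rightarrow> (real \<Rightarrow> real) \<Rightarrow> real^'p^'n \<Rightarrow> real^'n \<Rightarrow> real^'p \<Rightarrow> real" where
  "null_profile_loss \<phi> g f X y \<beta> =
     composite_loss \<phi> g f X \<beta> (fst (nuisance_est g f y)) (snd (nuisance_est g f y)) y"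

definition zero_threshold ::
  "(real \<Rightarrow> real) \<Rightarrow> (real \<Rightarrow> real) \<Rightarrow> (real \<Rightarrow> real) \<Rightarrow> real^'p^'n \<Rightarrow> real^'n \<Rightarrow> real" where
  "zero_threshold \<phi> g f X y = infnorm (gradient (null_profile_loss \<phi> g f X y) 0)"

text \<open>The completion is needed because the estimators, hence the statistic, are only determined
  up to a null set of observations.\<close>

definition finite_sample_pivotal ::
  "(real \<Rightarrow> real) \<Rightarrow> (real \<Rightarrow> real) \<Rightarrow> (real \<Rightarrow> real) \<Rightarrow> real^'p^'n \<Rightarrow> bool" where
  "finite_sample_pivotal \<phi> g f X \<longleftrightarrow>
     (\<exists>Q. \<forall>\<beta>0 \<sigma>. 0 < \<sigma> \<longrightarrow>
        zero_threshold \<phi> g f X \<in> borel_measurable (completion (null_law g f X \<beta>0 \<sigma>)) \<and>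
        distr (completion (null_law g f X \<beta>0 \<sigma>)) borel (zero_threshold \<phi> g f X) = Q)"

end

theory Submission
  imports Defs
begin

text \<open>Equivariance: for \<open>a > 0\<close> the sample \<open>b + a y\<close> has null MLE \<open>(b + a \<theta>, a \<sigma>)\<close> if \<open>y\<close> has
  null MLE \<open>(\<theta>, \<sigma>)\<close>, and the profile loss of \<open>b + a y\<close> at \<open>\<beta>\<close> is \<open>a\<close> times that of \<open>y\<close> at
  \<open>\<beta> / a\<close>. Hence the gradient at \<open>0\<close> is invariant, while the null law with parameters \<open>(b, a)\<close> is
  the image of the one with parameters \<open>(0, 1)\<close> under \<open>y \<mapsto> b + a y\<close>.

  The delicate point is the measurability of the estimator when \<open>f\<close> is merely Borel. The Hessian
  condition makes the likelihood continuous at the minimizer, so up to a null set the graph of the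
  estimator is Borel and preimages of Borel sets are projections of Borel sets. These are analytic,
  hence measurable for the completion of any finite Borel measure.\<close>

section \<open>Analytic sets\<close>

text \<open>Suslin sets, with real sequences in the product topology as witness space. Real
  coordinates can store inverses, indices and Euclidean coordinates, and bounding each of them
  leaves a compact set.\<close>

definition analytic_set :: "'a::metric_space set \<Rightarrow> bool" where
  "analytic_set A \<longleftrightarrow> (\<exists>C :: ('a \<times> (nat \<Rightarrow> real)) set. closed C \<and> A = fst ` C)"

lemma analytic_setI:
  fixes C :: "('a::metric_space \<times> (nat \<Rightarrow> real)) set"
  assumes "closed C" "\<And>x. x \<in> A \<longleftrightarrow> (\<exists>\<omega>. (x, \<omega>) \<in> C)"
  shows "analytic_set A"
  unfolding analytic_set_def using assms by (intro exI[of _ C]) force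

lemma analytic_setE:
  assumes "analytic_set A"
  obtains C :: "('a::metric_space \<times> (nat \<Rightarrow> real)) set"
  where "closed C" "\<And>x. x \<in> A \<longleftrightarrow> (\<exists>\<omega>. (x, \<omega>) \<in> C)"
  using assms unfolding analytic_set_def by force

lemma continuous_on_apply_snd [continuous_intros]:
  "continuous_on S (\<lambda>p::'a::topological_space \<times> ('i \<Rightarrow> 'b::topological_space). snd p i)"
  by (rule continuous_on_compose2[OF continuous_on_product_coordinates])
    (auto intro: continuous_intros)

lemma continuous_on_reindex_snd [continuous_intros]:
  "continuous_on S (\<lambda>p::'a::topological_space \<times> (nat \<Rightarrow> 'b::topological_space). (\<lambda>k. snd p (g k)) :: nat \<Rightarrow> 'b)"
  by (intro continuous_on_coordinatewise_then_product continuous_on_apply_snd)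

lemma closed_imp_analytic_set:
  assumes "closed A"
  shows "analytic_set A"
  by (rule analytic_setI[of "A \<times> UNIV"]) (use assms in \<open>auto intro: closed_Times\<close>)

text \<open>Having positive distance to the complement is an open condition; it becomes closed once
  a witness \<open>\<omega> 0\<close> has to be the inverse of that distance.\<close>

lemma open_imp_analytic_set:
  fixes A :: "'a::metric_space set"
  assumes "open A"
  shows "analytic_set A"
\<comment> \<open>The whole space is separate because \<open>infdist x {}\<close> is
  \<open>0\<close> by convention and has no inverse.\<close>
proof (cases "A = UNIV")
  case True
  then show ?thesis by (simp add: closed_imp_analytic_set)
next
  case False
  show ?thesis
  proof (rule analytic_setI)
    show "closed {p :: 'a \<times> (nat \<Rightarrow> real). snd p 0 * infdist (fst p) (- A) = 1}"
      by (intro closed_Collect_eq continuous_on_mult continuous_on_infdist continuous_on_apply_snd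
          continuous_on_fst continuous_on_id continuous_on_const)
    fix x
    have "closed (- A)" "- A \<noteq> {}"
      using False assms closed_Compl by blast+
    then have "x \<in> - A \<longleftrightarrow> infdist x (- A) = 0"
      by (rule in_closed_iff_infdist_zero)
    then have "x \<in> A \<longleftrightarrow> infdist x (- A) \<noteq> 0"
      unfolding Compl_iff by argo
    also have "\<dots> \<longleftrightarrow> (\<exists>\<omega>::nat \<Rightarrow> real. \<omega> 0 * infdist x (- A) = 1)"
    proof
      assume "infdist x (- A) \<noteq> 0"
      then show "\<exists>\<omega>::nat \<Rightarrow> real. \<omega> 0 * infdist x (- A) = 1"
        by (intro exI[of _ "\<lambda>_. inverse (infdist x (- A))"] left_inverse)
    next
      assume "\<exists>\<omega>::nat \<Rightarrow> real. \<omega> 0 * infdist x (- A) = 1"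
      then show "infdist x (- A) \<noteq> 0"
        by (metis mult_zero_right zero_neq_one)
    qed
    finally show "x \<in> A \<longleftrightarrow> (\<exists>\<omega>. (x, \<omega>) \<in> {p :: 'a \<times> (nat \<Rightarrow> real). snd p 0 * infdist (fst p) (- A) = 1})"
      unfolding mem_Collect_eq fst_conv snd_conv .
  qed
qed

text \<open>Coordinate \<open>0\<close> of the witness names an index \<open>n\<close>, and the
  shifted sequence is a witness for membership in \<open>A n\<close>.\<close>

lemma analytic_set_UN:
  fixes A :: "nat \<Rightarrow> 'a::metric_space set"
  assumes "\<And>n. analytic_set (A n)"
  shows "analytic_set (\<Union>n. A n)"
proof -
  have "\<forall>n. \<exists>C :: ('a \<times> (nat \<Rightarrow> real)) set. closed C \<and> (\<forall>x. x \<in> A n \<longleftrightarrow> (\<exists>\<omega>. (x, \<omega>) \<in> C))"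
    using assms by (metis analytic_setE)
  then obtain C :: "nat \<Rightarrow> ('a \<times> (nat \<Rightarrow> real)) set"
    where C: "\<And>n. closed (C n)" "\<And>n x. x \<in> A n \<longleftrightarrow> (\<exists>\<omega>. (x, \<omega>) \<in> C n)"
    by metis
  \<comment> \<open>"If coordinate \<open>0\<close> is \<open>n\<close>, then the tail lies in
    \<open>C n\<close>" is written as a union of two closed conditions; this is faithful because
    distinct integers are at least \<open>1\<close> apart.\<close>
  define D where "D = {p :: 'a \<times> (nat \<Rightarrow> real). snd p 0 \<in> \<int>} \<inter>
    (\<Inter>n. {p. 1 \<le> \<bar>snd p 0 - real n\<bar>} \<union> ((\<lambda>p. (fst p, \<lambda>k. snd p (Suc k))) -` C n)) \<inter> {p. 0 \<le> snd p 0}"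
  show ?thesis
  proof (rule analytic_setI)
    show "closed D"
      unfolding D_def
      by (intro closed_Int closed_INT ballI closed_Un closed_Collect_le continuous_intros
          closed_vimage C closed_vimage[OF closed_Ints, unfolded vimage_def])
    fix x
    show "x \<in> (\<Union>n. A n) \<longleftrightarrow> (\<exists>\<omega>. (x, \<omega>) \<in> D)"
    proof
      assume "x \<in> (\<Union>n. A n)"
      then obtain n \<omega> where "(x, \<omega>) \<in> C n"
        using C(2) by auto
      moreover have "1 \<le> \<bar>real n - real m\<bar>" if "n \<noteq> m" for m
        using that by linarith
      ultimately have "(x, case_nat (real n) \<omega>) \<in> D"
        unfolding D_def by (auto; metis)
      then show "\<exists>\<omega>. (x, \<omega>) \<in> D"
        by blast
    next
      assume "\<exists>\<omega>. (x, \<omega>) \<in> D"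
      then obtain \<omega> where \<omega>: "(x, \<omega>) \<in> D" ..
      then have "\<omega> 0 \<in> \<int>" "0 \<le> \<omega> 0"
        by (auto simp: D_def)
      then obtain n where "\<omega> 0 = real n"
        by (metis Ints_cases of_int_0_le_iff of_int_of_nat_eq zero_le_imp_eq_int)
      moreover have "1 \<le> \<bar>\<omega> 0 - real n\<bar> \<or> (x, \<lambda>k. \<omega> (Suc k)) \<in> C n"
        using \<omega> unfolding D_def by auto
      ultimately have "(x, \<lambda>k. \<omega> (Suc k)) \<in> C n"
        by simp
      then show "x \<in> (\<Union>n. A n)"
        using C(2) by blast
    qed
  qed
qed

text \<open>One sequence stores a witness for every index: \<open>prod_encode\<close> splits its
  positions into countably many rows, and row \<open>n\<close> serves \<open>A n\<close>.\<close>

lemma analytic_set_INT: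
  fixes A :: "nat \<Rightarrow> 'a::metric_space set"
  assumes "\<And>n. analytic_set (A n)"
  shows "analytic_set (\<Inter>n. A n)"
proof -
  have "\<forall>n. \<exists>C :: ('a \<times> (nat \<Rightarrow> real)) set. closed C \<and> (\<forall>x. x \<in> A n \<longleftrightarrow> (\<exists>\<omega>. (x, \<omega>) \<in> C))"
    using assms by (metis analytic_setE)
  then obtain C :: "nat \<Rightarrow> ('a \<times> (nat \<Rightarrow> real)) set"
    where C: "\<And>n. closed (C n)" "\<And>n x. x \<in> A n \<longleftrightarrow> (\<exists>\<omega>. (x, \<omega>) \<in> C n)"
    by metis
  define D where "D = (\<Inter>n. (\<lambda>p. (fst p, \<lambda>k. snd p (prod_encode (n, k)))) -` C n)"
  show ?thesis
  proof (rule analytic_setI)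
    show "closed D"
      unfolding D_def by (intro closed_INT ballI closed_vimage C continuous_intros)
    fix x
    show "x \<in> (\<Inter>n. A n) \<longleftrightarrow> (\<exists>\<omega>. (x, \<omega>) \<in> D)"
    proof
      assume "x \<in> (\<Inter>n. A n)"
      then have "\<forall>n. \<exists>\<omega>. (x, \<omega>) \<in> C n"
        using C(2) by simp
      then obtain \<omega> where "\<And>n. (x, \<omega> n) \<in> C n"
        by metis
      then have "(x, \<lambda>j. case_prod \<omega> (prod_decode j)) \<in> D"
        unfolding D_def by simp
      then show "\<exists>\<omega>. (x, \<omega>) \<in> D"
        by blast
    next
      assume "\<exists>\<omega>. (x, \<omega>) \<in> D"
      then show "x \<in> (\<Inter>n. A n)"
        unfolding D_def using C(2) by auto
    qed
  qed
qed

text \<open>Analytic sets are not closed under complement in general, so the induction carries the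
  claim for a set together with its complement; unions and intersections then trade places.\<close>

lemma borel_imp_analytic_set:
  fixes A :: "'a::metric_space set"
  assumes "A \<in> sets borel"
  shows "analytic_set A"
proof -
  have "A \<in> sigma_sets UNIV {S. open S}"
    using assms by (simp add: borel_def)
  then have "analytic_set A \<and> analytic_set (- A)"
  proof induction
    case (Basic S)
    then show ?case
      by (auto intro: open_imp_analytic_set closed_imp_analytic_set)
  next
    case Empty
    then show ?case
      by (auto intro: closed_imp_analytic_set)
  next
    case (Compl S)
    then show ?case
      by (simp add: Compl_eq_Diff_UNIV[symmetric])
  next
    case (Union S)
    then show ?case
      by (auto intro: analytic_set_UN analytic_set_INT simp: Compl_UN)
  qed
  then show ?thesis ..
qed

text \<open>The coordinate that is projected away moves into the witness: even positions encode it
  through the continuous surjection \<open>h\<close>, odd positions keep the old witness.\<close>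

lemma analytic_set_fst_image:
  fixes B :: "('a::metric_space \<times> 'b::euclidean_space) set"
  assumes "analytic_set B"
  shows "analytic_set (fst ` B)"
proof -
  obtain C where C: "closed C" "\<And>z. z \<in> B \<longleftrightarrow> (\<exists>\<omega>::nat \<Rightarrow> real. (z, \<omega>) \<in> C)"
    using assms by (auto elim: analytic_setE)
  define h :: "(nat \<Rightarrow> real) \<Rightarrow> 'b" where "h \<omega> = (\<Sum>b\<in>Basis. \<omega> (to_nat_on Basis b) *\<^sub>R b)" for \<omega>
  have h_surj: "\<exists>\<omega>. t = h \<omega>" for t
  proof
    show "t = h (\<lambda>k. inner t (from_nat_into Basis k))"
      unfolding h_def
      by (simp add: countable_finite euclidean_representation cong: sum.cong)
  qed
  define D where "D = (\<lambda>p. ((fst p, h (\<lambda>k. snd p (2 * k))), \<lambda>k. snd p (2 * k + 1))) -` C"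
  show ?thesis
  proof (rule analytic_setI)
    show "closed D"
      unfolding D_def h_def by (intro closed_vimage C continuous_intros)
    fix x
    show "x \<in> fst ` B \<longleftrightarrow> (\<exists>\<omega>. (x, \<omega>) \<in> D)"
    proof
      assume "x \<in> fst ` B"
      then obtain t \<omega> where t: "((x, t), \<omega>) \<in> C"
        using C(2) by auto
      obtain \<omega>' where "t = h \<omega>'"
        using h_surj by blast
      with t have "(x, \<lambda>j. if even j then \<omega>' (j div 2) else \<omega> (j div 2)) \<in> D"
        unfolding D_def by simp
      then show "\<exists>\<omega>. (x, \<omega>) \<in> D"
        by blast
    next
      assume "\<exists>\<omega>. (x, \<omega>) \<in> D"
      then show "x \<in> fst ` B"
        unfolding D_def using C(2) by force
    qed
  qed
qed

section \<open>Inner approximation by closed sets and universal measurability\<close>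

lemma bounded_coordinates_convergent_subseq:
  fixes \<omega> :: "nat \<Rightarrow> nat \<Rightarrow> real"
  assumes "\<And>k i. i < k \<Longrightarrow> \<bar>\<omega> k i\<bar> \<le> N i"
  obtains r l where "strict_mono (r :: nat \<Rightarrow> nat)" "(\<omega> \<circ> r) \<longlonglongrightarrow> l" "\<And>i. \<bar>l i\<bar> \<le> N i"
proof -
  \<comment> \<open>Coordinate \<open>i\<close> is bounded by \<open>N i\<close> only from
    \<open>k > i\<close> on. The maximum also covers the finitely many earlier terms, so that the
    whole sequence lies in a product of compact intervals (Tychonoff).\<close>
  define M where "M i = Max (insert (N i) ((\<lambda>k. \<bar>\<omega> k i\<bar>) ` {..i}))" for i
  define K where "K = (\<Pi>\<^sub>E i\<in>UNIV. {- M i..M i})"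
  have "\<bar>\<omega> k i\<bar> \<le> M i" for k i
  proof (cases "i < k")
    case True
    then show ?thesis
      using assms[of i k] by (force simp: M_def intro: order_trans Max_ge)
  next
    case False
    then show ?thesis
      unfolding M_def by (intro Max_ge) auto
  qed
  then have "- M i \<le> \<omega> k i \<and> \<omega> k i \<le> M i" for k i
    by (metis abs_le_D1 abs_le_D2 minus_le_iff)
  then have "\<omega> k \<in> K" for k
    by (auto simp: K_def)
  moreover have "compact K"
    using compactin_PiE[of "\<lambda>_. euclidean" UNIV "\<lambda>i. {- M i..M i}"]
    by (simp add: K_def euclidean_product_topology)
  ultimately obtain l r where r: "strict_mono (r :: nat \<Rightarrow> nat)" "(\<omega> \<circ> r) \<longlonglongrightarrow> l"
    by (meson compact_imp_seq_compact seq_compactE)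
  \<comment> \<open>The limit obeys the original bound, since \<open>i < r j\<close> for all large
    \<open>j\<close>.\<close>
  have "\<bar>l i\<bar> \<le> N i" for i
  proof -
    have "(\<lambda>j. \<bar>(\<omega> \<circ> r) j i\<bar>) \<longlonglongrightarrow> \<bar>l i\<bar>"
      by (rule tendsto_rabs, rule continuous_on_tendsto_compose[OF continuous_on_product_coordinates r(2)]) auto
    moreover have "\<forall>\<^sub>F j in sequentially. \<bar>(\<omega> \<circ> r) j i\<bar> \<le> N i"
      using eventually_gt_at_top[of i]
    proof eventually_elim
      case (elim j)
      then have "i < r j"
        using seq_suble[OF r(1), of j] by simp
      then show ?case
        using assms by simp
    qed
    ultimately show ?thesis
      by (rule tendsto_upperbound) simp
  qed
  with r show ?thesis
    using that by blast
qed

text \<open>The analytic set is exhausted by the projections of sets on which more and more of the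
  auxiliary coordinates are bounded; in the limit the bounded coordinates range over a compact
  set, and projecting along it preserves closedness.\<close>

lemma analytic_set_inner_closed:
  fixes A :: "'a::metric_space set"
  assumes "finite_measure M" and sets_M: "sets M = sets borel"
    and A: "analytic_set A" and c: "c < outer_measure_of M A"
  shows "\<exists>K. closed K \<and> K \<subseteq> A \<and> c \<le> emeasure M K"
proof -
  interpret finite_measure M by fact
  have space_M: "space M = UNIV"
    using sets_eq_imp_space_eq[OF sets_M] by simp
  obtain C where C: "closed C" "\<And>x. x \<in> A \<longleftrightarrow> (\<exists>\<omega>::nat \<Rightarrow> real. (x, \<omega>) \<in> C)"
    using A by (auto elim: analytic_setE)
  define pr where "pr W = {x. \<exists>\<omega>\<in>W. (x, \<omega>) \<in> C}" for W
  define bd where "bd k n = {\<omega> :: nat \<Rightarrow> real. \<bar>\<omega> k\<bar> \<le> real n}" for k n :: nat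
  \<comment> \<open>Step \<open>k\<close> bounds coordinate \<open>k\<close> and keeps the outer
    measure of the projection above \<open>c\<close>. The clause for \<open>k = 0\<close> fixes the
    starting set of the recursion.\<close>
  have "\<exists>W. \<forall>k. (c < outer_measure_of M (pr (W k)) \<and> (k = 0 \<longrightarrow> W k = UNIV))
      \<and> (\<exists>n. W (Suc k) = W k \<inter> bd k n)"
  proof (rule dependent_nat_choice)
    show "\<exists>W. c < outer_measure_of M (pr W) \<and> (0 = (0::nat) \<longrightarrow> W = UNIV)"
      using c C(2) by (intro exI[of _ UNIV]) (simp add: pr_def flip: C(2))
    fix W and k :: nat
    assume W: "c < outer_measure_of M (pr W) \<and> (k = 0 \<longrightarrow> W = UNIV)"
    have "(\<Union>n. pr (W \<inter> bd k n)) = pr W"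
    proof (intro equalityI subsetI)
      fix x assume "x \<in> pr W"
      then obtain \<omega> where \<omega>: "\<omega> \<in> W" "(x, \<omega>) \<in> C"
        by (auto simp: pr_def)
      obtain n where "\<bar>\<omega> k\<bar> \<le> real n"
        using real_arch_simple by blast
      with \<omega> show "x \<in> (\<Union>n. pr (W \<inter> bd k n))"
        by (auto simp: pr_def bd_def)
    qed (auto simp: pr_def)
    moreover have "incseq (\<lambda>n. pr (W \<inter> bd k n))"
      by (force simp: incseq_def pr_def bd_def)
    \<comment> \<open>Outer measure is continuous along increasing sequences of arbitrary sets, so
      the possibly non-measurable projections cause no trouble.\<close>
    ultimately have "(SUP n. outer_measure_of M (pr (W \<inter> bd k n))) = outer_measure_of M (pr W)"
      by (subst SUP_outer_measure_of_incseq) (auto simp: space_M)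
    with W have "c < (SUP n. outer_measure_of M (pr (W \<inter> bd k n)))"
      by simp
    then obtain n where "c < outer_measure_of M (pr (W \<inter> bd k n))"
      by (auto simp: less_SUP_iff)
    then show "\<exists>W'. (c < outer_measure_of M (pr W') \<and> (Suc k = 0 \<longrightarrow> W' = UNIV)) \<and> (\<exists>n. W' = W \<inter> bd k n)"
      by blast
  qed
  then obtain W N where W: "\<And>k. c < outer_measure_of M (pr (W k))" "\<And>k. W (Suc k) = W k \<inter> bd k (N k)" "W 0 = UNIV"
    by metis
  have W_eq: "W k = {\<omega>. \<forall>i<k. \<bar>\<omega> i\<bar> \<le> real (N i)}" for k
    by (induction k) (auto simp: W bd_def less_Suc_eq)
  \<comment> \<open>Closures are measurable and decrease, so finiteness of \<open>M\<close> carries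
    the bound \<open>c\<close> to \<open>K\<close>. Passing to closures does not leave
    \<open>A\<close> in the limit: witnesses of approximating points have a convergent subsequence,
    and \<open>C\<close> is closed.\<close>
  define K where "K = (\<Inter>k. closure (pr (W k)))"
  have "K \<subseteq> A"
  proof
    fix x assume "x \<in> K"
    then have "\<forall>k. \<exists>z\<in>pr (W k). dist z x < 1 / Suc k"
      unfolding K_def by (auto simp: closure_approachable)
    then obtain z where z: "\<And>k. z k \<in> pr (W k)" "\<And>k. dist (z k) x < 1 / Suc k"
      by metis
    then obtain \<omega> where \<omega>: "\<And>k. \<omega> k \<in> W k" "\<And>k. (z k, \<omega> k) \<in> C"
      unfolding pr_def by (simp; metis)
    have "\<bar>\<omega> k i\<bar> \<le> real (N i)" if "i < k" for k i
      using \<omega>(1)[of k] that by (simp add: W_eq)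
    then obtain r l where r: "strict_mono (r :: nat \<Rightarrow> nat)" "(\<omega> \<circ> r) \<longlonglongrightarrow> l"
      by (rule bounded_coordinates_convergent_subseq) blast
    have "(\<lambda>k. dist (z k) x) \<longlonglongrightarrow> 0"
      by (rule real_tendsto_sandwich[OF _ _ tendsto_const LIMSEQ_Suc[OF lim_1_over_n]])
        (use z(2) in \<open>auto intro!: always_eventually less_imp_le\<close>)
    then have "z \<longlonglongrightarrow> x"
      by (rule tendsto_dist_iff[THEN iffD2])
    then have "(\<lambda>j. ((z \<circ> r) j, (\<omega> \<circ> r) j)) \<longlonglongrightarrow> (x, l)"
      by (intro tendsto_Pair LIMSEQ_subseq_LIMSEQ[OF _ r(1)] r(2))
    then have "(x, l) \<in> C"
      by (rule closed_sequentially[OF C(1), rotated]) (simp add: \<omega>(2))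
    then show "x \<in> A"
      using C(2) by blast
  qed
  moreover have "c \<le> emeasure M K"
  proof -
    have "c \<le> emeasure M (closure (pr (W k)))" for k
      using W(1)[of k] outer_measure_of_mono[OF closure_subset, of M "pr (W k)"]
      by (simp add: sets_M)
    moreover have "decseq (\<lambda>k. closure (pr (W k)))"
      unfolding decseq_Suc_iff using W(2) by (intro allI closure_mono) (auto simp: pr_def)
    ultimately show ?thesis
      unfolding K_def
      by (subst INF_emeasure_decseq[symmetric]) (auto simp: sets_M intro: INF_greatest)
  qed
  moreover have "closed K"
    unfolding K_def by auto
  ultimately show ?thesis
    by blast
qed

text \<open>The set is squeezed between a countable union of closed subsets and a measurable hull
  \<open>B\<close> of the same finite measure.\<close>

lemma analytic_set_completion_measurable:
  fixes A :: "'a::metric_space set"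
  assumes "finite_measure M" and sets_M: "sets M = sets borel" and A: "analytic_set A"
  shows "A \<in> sets (completion M)"
proof -
  interpret finite_measure M by fact
  have space_M: "space M = UNIV"
    using sets_eq_imp_space_eq[OF sets_M] by simp
  obtain B where B: "B \<in> sets M" "A \<subseteq> B" "outer_measure_of M A = emeasure M B"
    using outer_measure_of_attain[of A M] by (auto simp: space_M)
  show ?thesis
  proof (cases "emeasure M B = 0")
    case True
    then show ?thesis
      using B by (intro sets_completionI_sub[of B]) (auto simp: null_sets_def)
  next
    case False
    \<comment> \<open>The inner approximation needs a level strictly below the outer measure; such
      levels exist only when the hull is not null.\<close>
    then obtain c where c: "\<And>n::nat. c n < emeasure M B" "c \<longlonglongrightarrow> emeasure M B"
      using approx_from_below_dense_linorder[of 0 "emeasure M B"] by (auto simp: zero_less_iff_neq_zero)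
    have "\<forall>n. \<exists>K. closed K \<and> K \<subseteq> A \<and> c n \<le> emeasure M K"
      using analytic_set_inner_closed[OF assms] c(1) B(3) by simp
    then obtain K where K: "\<And>n. closed (K n)" "\<And>n. K n \<subseteq> A" "\<And>n. c n \<le> emeasure M (K n)"
      by metis
    have K_sets: "(\<Union>n. K n) \<in> sets M"
      using K(1) by (auto simp: sets_M)
    have "c n \<le> emeasure M (\<Union>n. K n)" for n
      by (rule order_trans[OF K(3) emeasure_mono]) (use K_sets in auto)
    then have "emeasure M B \<le> emeasure M (\<Union>n. K n)"
      using c(2) by (auto intro: LIMSEQ_le_const2)
    moreover have "emeasure M (\<Union>n. K n) \<le> emeasure M B"
      using K(2) B by (intro emeasure_mono) auto
    ultimately have eq: "emeasure M (\<Union>n. K n) = emeasure M B"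
      by (rule antisym[rotated])
    have em: "emeasure (completion M) S = emeasure M S" if "S \<in> sets M" for S
      using that by simp
    show ?thesis
    proof (rule completion.complete_sets_sandwich)
      show "(\<Union>n. K n) \<in> sets (completion M)" "B \<in> sets (completion M)"
        by (rule sets_completionI_sets, fact)+
      show "(\<Union>n. K n) \<subseteq> A" "A \<subseteq> B"
        using K(2) B(2) by blast+
      show "emeasure (completion M) (\<Union>n. K n) = emeasure (completion M) B"
        unfolding em[OF K_sets] em[OF B(1)] by (rule eq)
      show "emeasure (completion M) (\<Union>n. K n) < \<infinity>"
        unfolding em[OF K_sets] using emeasure_finite by (simp add: less_top[symmetric])
    qed
  qed
qed

section \<open>Affine equivariance\<close>

definition affine_map :: "real \<Rightarrow> real \<Rightarrow> real^'n \<Rightarrow> real^'n" where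
  "affine_map b a y = (\<chi> i. b + a * y $ i)"

lemma affine_map_inverse:
  assumes "a \<noteq> 0"
  shows "affine_map (- b / a) (1 / a) (affine_map b a y) = y"
  using assms by (simp add: affine_map_def vec_eq_iff field_simps)

text \<open>The standardized residuals are unchanged, so only the term \<open>ln \<sigma>\<close>
  moves.\<close>

lemma avg_nll_affine_map:
  fixes y :: "real^'n"
  assumes "0 < a" "0 < \<sigma>"
  shows "avg_nll f (affine_map b a \<theta>) (a * \<sigma>) (affine_map b a y) = ln a + avg_nll f \<theta> \<sigma> y"
proof -
  have "(b + a * u - (b + a * v)) / (a * \<sigma>) = (u - v) / \<sigma>" for u v
  proof -
    have "(b + a * u - (b + a * v)) / (a * \<sigma>) = (a * (u - v)) / (a * \<sigma>)"
      by (simp add: algebra_simps)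
    then show ?thesis
      using assms by simp
  qed
  then show ?thesis
    using assms by (simp add: avg_nll_def affine_map_def ln_mult_pos)
qed

lemma is_null_mle_affine_map:
  assumes a: "0 < a" and mle: "is_null_mle f y (\<theta>, \<sigma>)"
  shows "is_null_mle f (affine_map b a y) (b + a * \<theta>, a * \<sigma>)"
proof -
  have nll: "null_nll f (affine_map b a y) (b + a * t, a * s) = ln a + null_nll f y (t, s)" if "0 < s" for t s
    using avg_nll_affine_map[OF a that, of f b "\<chi> i. t" y]
    by (simp add: null_nll_def affine_map_def)
  have \<sigma>: "0 < \<sigma>" and min: "\<And>t s. 0 < s \<Longrightarrow> null_nll f y (\<theta>, \<sigma>) \<le> null_nll f y (t, s)"
    using mle by (auto simp: is_null_mle_def is_arg_min_def not_less) (meson linorder_not_less)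
  \<comment> \<open>Each competitor \<open>(t, s)\<close> is the image of
    \<open>((t - b) / a, s / a)\<close>, and both values shift by the same constant
    \<open>ln a\<close>.\<close>
  have "null_nll f (affine_map b a y) (b + a * \<theta>, a * \<sigma>) \<le> null_nll f (affine_map b a y) (t, s)" if "0 < s" for t s
    using nll[OF \<sigma>, of \<theta>] nll[of "s / a" "(t - b) / a"] min[of "s / a" "(t - b) / a"] a that
    by simp
  then show ?thesis
    using a \<sigma> by (auto simp: is_null_mle_def is_arg_min_def dest: leD)
qed

lemma null_mle_eqI:
  assumes "is_null_mle f y \<tau>" "\<And>\<tau>'. is_null_mle f y \<tau>' \<Longrightarrow> \<tau>' = \<tau>"
  shows "null_mle f y = \<tau>"
  unfolding null_mle_def using assms by (rule the_equality)

lemma is_null_mle_null_mle: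
  assumes "\<exists>!\<tau>. is_null_mle f y \<tau>"
  shows "is_null_mle f y (null_mle f y)"
  unfolding null_mle_def using assms by (rule theI')

text \<open>Uniqueness is pulled back: the inverse affine map turns any minimizer for the
  transformed sample into one for \<open>y\<close>.\<close>

lemma null_mle_affine_map:
  assumes a: "0 < a" and ex1: "\<exists>!\<tau>. is_null_mle f y \<tau>" and eq: "null_mle f y = (\<theta>, \<sigma>)"
  shows "null_mle f (affine_map b a y) = (b + a * \<theta>, a * \<sigma>)"
proof (rule null_mle_eqI)
  have mle: "is_null_mle f y (\<theta>, \<sigma>)"
    using is_null_mle_null_mle[OF ex1] eq by simp
  then show "is_null_mle f (affine_map b a y) (b + a * \<theta>, a * \<sigma>)"
    by (rule is_null_mle_affine_map[OF a])
  fix \<tau> assume \<tau>: "is_null_mle f (affine_map b a y) \<tau>"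
  obtain t s where ts: "\<tau> = (t, s)"
    by fastforce
  have "is_null_mle f y (- b / a + 1 / a * t, 1 / a * s)"
    using is_null_mle_affine_map[of "1 / a" f "affine_map b a y" t s "- b / a"] a \<tau>
      affine_map_inverse[of a b y] by (simp add: ts)
  with ex1 mle have "- b / a + 1 / a * t = \<theta>" "1 / a * s = \<sigma>"
    by blast+
  then show "\<tau> = (b + a * \<theta>, a * \<sigma>)"
    using a by (auto simp: ts field_simps)
qed

text \<open>For the identity link the condition determines the pair, so the choice operator is
  resolved for every \<open>y\<close>, whether or not a minimizer exists.\<close>

lemma nuisance_est_id: "nuisance_est id f y = null_mle f y"
proof -
  have "is_nuisance_est id f y = (\<lambda>\<tau>. \<tau> = null_mle f y)"
    by (auto simp: is_nuisance_est_def fun_eq_iff prod_eq_iff)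
  then show ?thesis
    by (simp add: nuisance_est_def)
qed

lemma null_profile_loss_id:
  assumes "null_mle f y = (\<theta>, \<sigma>)"
  shows "null_profile_loss exp id f X y \<beta> = exp (avg_nll f (\<chi> i. \<theta> + (X *v \<beta>) $ i) \<sigma> y)"
  using assms
  by (simp add: null_profile_loss_def composite_loss_def nuisance_est_id location_def linear_predictor_def)

text \<open>The exponential turns the additive constant \<open>ln a\<close> into a factor \<open>a\<close>, which the
  chain rule applied to \<open>\<beta> / a\<close> cancels in the gradient.\<close>

lemma null_profile_loss_affine_map:
  fixes y :: "real^'n" and X :: "real^'p^'n"
  assumes a: "0 < a" and ex1: "\<exists>!\<tau>. is_null_mle f y \<tau>"
  shows "null_profile_loss exp id f X (affine_map b a y) \<beta> = a * null_profile_loss exp id f X y (\<beta> /\<^sub>R a)"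
proof -
  obtain \<theta> \<sigma> where eq: "null_mle f y = (\<theta>, \<sigma>)"
    by fastforce
  then have \<sigma>: "0 < \<sigma>"
    using is_null_mle_null_mle[OF ex1] by (simp add: is_null_mle_def is_arg_min_def)
  have "(\<chi> i. b + a * \<theta> + (X *v \<beta>) $ i) = affine_map b a (\<chi> i. \<theta> + (X *v (\<beta> /\<^sub>R a)) $ i)"
    using a by (simp add: affine_map_def vec_eq_iff matrix_vector_mult_scaleR field_simps)
  then show ?thesis
    unfolding null_profile_loss_id[OF null_mle_affine_map[OF a ex1 eq]] null_profile_loss_id[OF eq]
    using a \<sigma> by (simp add: avg_nll_affine_map exp_add)
qed

section \<open>Gradients: uniqueness, rescaling and difference quotients\<close>

lemma gradient_eqI:
  assumes "GDERIV F x :> D"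
  shows "gradient F x = D"
  unfolding gradient_def
proof (rule the_equality, rule assms)
  fix D' assume "GDERIV F x :> D'"
  with assms have "(\<lambda>h. inner h D') = (\<lambda>h. inner h D)"
    unfolding gderiv_def by (rule has_derivative_unique[rotated])
  then show "D' = D"
    by (metis vector_eq_ldot)
qed

text \<open>Riesz representation: the adjoint of the derivative, applied to \<open>1\<close>, is the
  gradient.\<close>

lemma differentiable_imp_GDERIV_gradient:
  fixes F :: "'a::euclidean_space \<Rightarrow> real"
  assumes "F differentiable (at x)"
  shows "GDERIV F x :> gradient F x"
proof -
  obtain F' where F': "(F has_derivative F') (at x)"
    using assms by (auto simp: differentiable_def)
  then have "linear F'"
    by (rule has_derivative_linear)
  then have "F' = (\<lambda>h. inner h (adjoint F' 1))"
    by (simp add: adjoint_works)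
  then have "GDERIV F x :> adjoint F' 1"
    using F' unfolding gderiv_def by metis
  then show ?thesis
    by (simp add: gradient_eqI)
qed

lemma gradient_rescale:
  fixes F :: "'a::euclidean_space \<Rightarrow> real"
  assumes "F differentiable (at 0)" "a \<noteq> 0"
  shows "gradient (\<lambda>x. a * F (x /\<^sub>R a)) 0 = gradient F 0"
proof (rule gradient_eqI)
  have "(F has_derivative (\<lambda>h. inner h (gradient F 0))) (at (0 /\<^sub>R a))"
    using differentiable_imp_GDERIV_gradient[OF assms(1)] by (simp add: gderiv_def)
  from has_derivative_compose[where f = "\<lambda>x. x /\<^sub>R a" and x = 0 and s = UNIV, OF _ this, of "\<lambda>h. h /\<^sub>R a"]
  have "((\<lambda>x. F (x /\<^sub>R a)) has_derivative (\<lambda>h. inner (h /\<^sub>R a) (gradient F 0))) (at 0)"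
    by (simp add: bounded_linear_scaleR_right bounded_linear_imp_has_derivative)
  then have "((\<lambda>x. a * F (x /\<^sub>R a)) has_derivative (\<lambda>h. a * inner (h /\<^sub>R a) (gradient F 0))) (at 0)"
    by (rule has_derivative_mult_right)
  then show "GDERIV (\<lambda>x. a * F (x /\<^sub>R a)) 0 :> gradient F 0"
    using assms(2) by (simp add: gderiv_def flip: mult.assoc)
qed

lemma zero_threshold_affine_map:
  assumes "0 < a" "\<exists>!\<tau>. is_null_mle f y \<tau>" "null_profile_loss exp id f X y differentiable (at 0)"
  shows "zero_threshold exp id f X (affine_map b a y) = zero_threshold exp id f X y"
proof -
  have "null_profile_loss exp id f X (affine_map b a y) = (\<lambda>\<beta>. a * null_profile_loss exp id f X y (\<beta> /\<^sub>R a))"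
    using null_profile_loss_affine_map[OF assms(1,2)] by blast
  then show ?thesis
    using gradient_rescale[OF assms(3)] assms(1) by (simp add: zero_threshold_def)
qed

text \<open>Writes the gradient as a limit of expressions in countably many values of
  \<open>F\<close>, through which measurability in the sample passes to the gradient.\<close>

lemma gradient_LIMSEQ:
  fixes F :: "'a::euclidean_space \<Rightarrow> real"
  assumes "F differentiable (at 0)"
  shows "(\<lambda>k. \<Sum>b\<in>Basis. (real (Suc k) * (F (b /\<^sub>R real (Suc k)) - F 0)) *\<^sub>R b) \<longlonglongrightarrow> gradient F 0"
proof -
  have "(\<lambda>k. real (Suc k) * (F (b /\<^sub>R real (Suc k)) - F 0)) \<longlonglongrightarrow> inner (gradient F 0) b" for b
  proof -
    have "(F has_derivative (\<lambda>h. inner h (gradient F 0))) (at (0 *\<^sub>R b))"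
      using differentiable_imp_GDERIV_gradient[OF assms] by (simp add: gderiv_def)
    from has_derivative_compose[where f = "\<lambda>t. t *\<^sub>R b" and x = 0 and s = UNIV, OF _ this, of "\<lambda>t. t *\<^sub>R b"]
    have "((\<lambda>t. F (t *\<^sub>R b)) has_derivative (\<lambda>t. inner (t *\<^sub>R b) (gradient F 0))) (at 0)"
      by (simp add: bounded_linear_scaleR_left bounded_linear_imp_has_derivative)
    then have "((\<lambda>t. F (t *\<^sub>R b)) has_field_derivative inner (gradient F 0) b) (at 0)"
      by (simp add: has_field_derivative_def inner_commute[of b] mult_commute_abs)
    then have "(\<lambda>k. (F (inverse (real (Suc k)) *\<^sub>R b) - F 0) / inverse (real (Suc k))) \<longlonglongrightarrow> inner (gradient F 0) b"
      unfolding has_field_derivative_iff using LIMSEQ_inverse_real_of_nat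
      by (auto elim!: filterlim_compose simp: filterlim_at intro!: always_eventually)
    then show ?thesis
      by (simp add: divide_inverse mult.commute)
  qed
  then have "(\<lambda>k. \<Sum>b\<in>Basis. (real (Suc k) * (F (b /\<^sub>R real (Suc k)) - F 0)) *\<^sub>R b)
      \<longlonglongrightarrow> (\<Sum>b\<in>Basis. inner (gradient F 0) b *\<^sub>R b)"
    by (intro tendsto_sum tendsto_scaleR tendsto_const)
  then show ?thesis
    by (simp add: euclidean_representation)
qed

section \<open>Measurability of the estimator and of the threshold\<close>

lemma borel_measurable_vec_nth [measurable (raw)]:
  fixes h :: "'a \<Rightarrow> real^'n"
  assumes "h \<in> borel_measurable M"
  shows "(\<lambda>x. h x $ i) \<in> borel_measurable M"
  using assms by (rule borel_measurable_continuous_on[rotated]) (intro continuous_intros)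

lemma borel_measurable_vec_lambda:
  assumes "\<And>i. (\<lambda>x. h x i) \<in> borel_measurable M"
  shows "(\<lambda>x. (\<chi> i. h x i) :: real^'n) \<in> borel_measurable M"
proof (rule borel_measurable_euclidean_space[THEN iffD2], rule ballI)
  fix b :: "real^'n"
  assume "b \<in> Basis"
  then obtain i where b: "b = axis i 1"
    by (metis axis_index)
  have "(\<lambda>x. inner (\<chi> i. h x i) b) = (\<lambda>x. h x i)"
    by (simp only: b inner_axis vec_lambda_beta inner_real_def mult_1_right)
  then show "(\<lambda>x. inner (\<chi> i. h x i) b) \<in> borel_measurable M"
    by (simp only: assms)
qed

lemma borel_measurable_avg_nll [measurable (raw)]:
  fixes y :: "'a \<Rightarrow> real^'n"
  assumes [measurable]: "f \<in> borel_measurable borel"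
    "\<theta> \<in> borel_measurable M" "\<sigma> \<in> borel_measurable M" "y \<in> borel_measurable M"
  shows "(\<lambda>x. avg_nll f (\<theta> x) (\<sigma> x) (y x)) \<in> borel_measurable M"
  unfolding avg_nll_def by measurable

lemma borel_measurable_components:
  fixes \<tau> :: "'a \<Rightarrow> 'b::topological_space \<times> 'c::topological_space"
  assumes "\<tau> \<in> borel_measurable M"
  shows "(\<lambda>x. fst (\<tau> x)) \<in> borel_measurable M" "(\<lambda>x. snd (\<tau> x)) \<in> borel_measurable M"
  by (rule borel_measurable_continuous_on[OF _ assms], intro continuous_on_fst continuous_on_snd continuous_on_id)+

lemma borel_measurable_null_nll:
  fixes y :: "'a \<Rightarrow> real^'n"
  assumes "f \<in> borel_measurable borel"
    and \<tau>: "\<tau> \<in> borel_measurable M" and "y \<in> borel_measurable M"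
  shows "(\<lambda>x. null_nll f (y x) (\<tau> x)) \<in> borel_measurable M"
proof -
  note [measurable] = borel_measurable_components[OF \<tau>]
  show ?thesis
    unfolding null_nll_def case_prod_beta
    by (intro borel_measurable_avg_nll borel_measurable_vec_lambda assms) measurable
qed

text \<open>Continuity at the minimizer allows testing minimality against countably many competitors
  only, so almost surely the graph of the estimator is a Borel set.\<close>

lemma is_null_mle_iff_dense:
  assumes D: "\<And>U :: (real \<times> real) set. open U \<Longrightarrow> U \<noteq> {} \<Longrightarrow> \<exists>d\<in>D. d \<in> U"
    and ex1: "\<exists>!\<tau>. is_null_mle f y \<tau>" and cont: "isCont (null_nll f y) (null_mle f y)"
  shows "0 < snd \<tau> \<and> (\<forall>d\<in>D. 0 < snd d \<longrightarrow> null_nll f y \<tau> \<le> null_nll f y d) \<longleftrightarrow> \<tau> = null_mle f y"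
    (is "?L \<longleftrightarrow> _")
proof
  let ?t = "null_mle f y"
  have mle: "0 < snd ?t" "\<And>s. 0 < snd s \<Longrightarrow> null_nll f y ?t \<le> null_nll f y s"
    using is_null_mle_null_mle[OF ex1] by (auto simp: is_null_mle_def is_arg_min_def case_prod_beta not_less) (meson linorder_not_less)
  show ?L if "\<tau> = ?t"
    using mle that by simp
  assume L: ?L
  have "null_nll f y \<tau> \<le> null_nll f y ?t"
  proof (rule ccontr)
    assume "\<not> null_nll f y \<tau> \<le> null_nll f y ?t"
    \<comment> \<open>By continuity a whole neighbourhood of the minimizer beats
      \<open>\<tau>\<close>; its part with positive scale is open and nonempty, so it contains a
      competitor from \<open>D\<close>.\<close>
    then have "\<forall>\<^sub>F s in nhds ?t. null_nll f y s < null_nll f y \<tau>"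
      using cont by (intro order_tendstoD(2)[where y = "null_nll f y ?t"]) (auto simp: isCont_def tendsto_at_iff_tendsto_nhds)
    then obtain U where U: "open U" "?t \<in> U" "\<And>s. s \<in> U \<Longrightarrow> null_nll f y s < null_nll f y \<tau>"
      unfolding eventually_nhds by blast
    have "open (U \<inter> {s. 0 < snd s})"
      using U(1) by (intro open_Int open_Collect_less continuous_intros)
    moreover have "U \<inter> {s. 0 < snd s} \<noteq> {}"
      using U(2) mle(1) by blast
    ultimately obtain d where "d \<in> D" "d \<in> U" "0 < snd d"
      using D by blast
    with U(3)[of d] L show False
      by force
  qed
  then have "null_nll f y \<tau> \<le> null_nll f y s" if "0 < snd s" for s
    using mle(2)[OF that] by (rule order_trans)
  then have "is_null_mle f y \<tau>"
    using L unfolding is_null_mle_def is_arg_min_def case_prod_beta by (meson leD)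
  then show "\<tau> = ?t"
    using ex1 is_null_mle_null_mle by blast
qed

text \<open>Up to a null set, the preimage of \<open>A\<close> is the projection of the Borel set
  \<open>R\<close>, and the completion absorbs the null set.\<close>

lemma borel_measurable_null_mle:
  fixes M :: "(real^'n) measure"
  assumes "finite_measure M" and sets_M: "sets M = sets borel"
    and f: "f \<in> borel_measurable borel"
    and ae: "AE y in M. (\<exists>!\<tau>. is_null_mle f y \<tau>) \<and> isCont (null_nll f y) (null_mle f y)"
  shows "null_mle f \<in> borel_measurable (completion M)"
proof (rule measurableI)
  fix A :: "(real \<times> real) set"
  assume A: "A \<in> sets borel"
  obtain D :: "(real \<times> real) set" where D: "countable D" "\<And>U. open U \<Longrightarrow> U \<noteq> {} \<Longrightarrow> \<exists>d\<in>D. d \<in> U"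
    by (erule countable_dense_setE)
  \<comment> \<open>For almost every \<open>y\<close> the section of \<open>R\<close> is the
    minimizer if it lies in \<open>A\<close>, and empty otherwise. Quantifying over the countable
    \<open>D\<close> keeps \<open>R\<close> Borel.\<close>
  define R where "R = {p :: (real^'n) \<times> real \<times> real. 0 < snd (snd p) \<and>
    (\<forall>d\<in>D. 0 < snd d \<longrightarrow> null_nll f (fst p) (snd p) \<le> null_nll f (fst p) d)} \<inter> {p. snd p \<in> A}"
  have fst_snd: "fst \<in> borel_measurable (borel :: ((real^'n) \<times> real \<times> real) measure)"
    "snd \<in> borel_measurable (borel :: ((real^'n) \<times> real \<times> real) measure)"
    by (intro borel_measurable_continuous_onI continuous_on_fst continuous_on_snd continuous_on_id)+
  have nll: "(\<lambda>p. null_nll f (fst p) (snd p)) \<in> borel_measurable (borel :: ((real^'n) \<times> real \<times> real) measure)"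
    "(\<lambda>p. null_nll f (fst p) d) \<in> borel_measurable (borel :: ((real^'n) \<times> real \<times> real) measure)" for d
    by (intro borel_measurable_null_nll f fst_snd borel_measurable_const)+
  have "R \<in> sets borel"
  proof -
    have eq: "R = {p. 0 < snd (snd p)} \<inter> (\<Inter>d\<in>D \<inter> {d. 0 < snd d}.
        {p. null_nll f (fst p) (snd p) \<le> null_nll f (fst p) d}) \<inter> snd -` A"
      by (auto simp: R_def)
    have "{p :: (real^'n) \<times> real \<times> real. 0 < snd (snd p)} \<in> sets borel"
      by (intro borel_open open_Collect_less continuous_on_fst continuous_on_snd continuous_on_id continuous_on_const)
    moreover have "{p :: (real^'n) \<times> real \<times> real. null_nll f (fst p) (snd p) \<le> null_nll f (fst p) d} \<in> sets borel" for d
      using borel_measurable_le[OF nll] by simp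
    moreover have "snd -` A \<in> sets (borel :: ((real^'n) \<times> real \<times> real) measure)"
      using measurable_sets[OF fst_snd(2) A] by simp
    ultimately show ?thesis
      unfolding eq using D(1) by (intro sets.Int sets.countable_INT'') auto
  qed
  then have fst_R: "fst ` R \<in> sets (completion M)"
    by (intro analytic_set_completion_measurable assms analytic_set_fst_image borel_imp_analytic_set)
  have "AE y in M. y \<in> fst ` R \<longleftrightarrow> y \<in> null_mle f -` A"
    using ae
  proof eventually_elim
    case (elim y)
    then have "(0 < snd \<tau> \<and> (\<forall>d\<in>D. 0 < snd d \<longrightarrow> null_nll f y \<tau> \<le> null_nll f y d))
        \<longleftrightarrow> \<tau> = null_mle f y" for \<tau>
      by (intro is_null_mle_iff_dense D(2)) simp_all
    then have R_iff: "(y, \<tau>) \<in> R \<longleftrightarrow> \<tau> = null_mle f y \<and> \<tau> \<in> A" for \<tau>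
      by (simp add: R_def)
    have "y \<in> fst ` R \<longleftrightarrow> (\<exists>\<tau>. (y, \<tau>) \<in> R)"
      by force
    then show ?case
      by (simp add: R_iff)
  qed
  then have "null_mle f -` A \<in> sets (completion M)"
    by (rule completion.in_sets_AE[OF AE_completion fst_R]) (simp add: sets_eq_imp_space_eq[OF sets_M])
  then show "null_mle f -` A \<inter> space (completion M) \<in> sets (completion M)"
    by (simp add: sets_eq_imp_space_eq[OF sets_M])
qed simp

lemma pos_def_Hessian_at_imp_isCont:
  assumes "pos_def_Hessian_at F x"
  shows "isCont F x"
proof -
  obtain G where "\<forall>\<^sub>F z in nhds x. GDERIV F z :> G z"
    using assms by (auto simp: pos_def_Hessian_at_def)
  then have "GDERIV F x :> G x"
    by (rule eventually_nhds_x_imp_x)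
  then show ?thesis
    unfolding gderiv_def by (rule has_derivative_continuous)
qed

lemma (in complete_measure) measurable_AE_cong:
  assumes g: "g \<in> measurable M N" and ae: "AE x in M. g x = h x"
    and h: "\<And>x. x \<in> space M \<Longrightarrow> h x \<in> space N"
  shows "h \<in> measurable M N"
proof (rule measurableI[OF h])
  fix A assume "A \<in> sets N"
  then have sets: "g -` A \<inter> space M \<in> sets M"
    by (rule measurable_sets[OF g])
  have "AE x in M. x \<in> g -` A \<inter> space M \<longleftrightarrow> x \<in> h -` A \<inter> space M"
    using ae by eventually_elim simp
  then show "h -` A \<inter> space M \<in> sets M"
    by (rule in_sets_AE[OF _ sets]) blast
qed

text \<open>At fixed \<open>\<beta>\<close> the profile loss is a Borel function of the sample and
  the estimator, and the gradient is almost everywhere the limit of its difference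
  quotients.\<close>

lemma borel_measurable_zero_threshold:
  fixes M :: "(real^'n) measure" and X :: "real^'p^'n"
  assumes f: "f \<in> borel_measurable borel" and sets_M: "sets M = sets borel"
    and mle: "null_mle f \<in> borel_measurable (completion M)"
    and ae: "AE y in M. null_profile_loss exp id f X y differentiable (at 0)"
  shows "zero_threshold exp id f X \<in> borel_measurable (completion M)"
proof -
  note [measurable] = borel_measurable_components[OF mle]
  have [measurable]: "(\<lambda>y. y) \<in> borel_measurable (completion M)"
    by (intro measurable_completion) (simp add: sets_M measurable_ident_sets)
  have loss [measurable]: "(\<lambda>y. null_profile_loss exp id f X y \<beta>) \<in> borel_measurable (completion M)" for \<beta>
    unfolding null_profile_loss_id[OF prod.collapse[symmetric]]
    by (intro borel_measurable_exp[THEN measurable_compose[rotated]] borel_measurable_avg_nll f borel_measurable_vec_lambda) measurable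
  define S where "S k y = (\<Sum>b\<in>Basis. (real (Suc k) *
    (null_profile_loss exp id f X y (b /\<^sub>R real (Suc k)) - null_profile_loss exp id f X y 0)) *\<^sub>R b)" for k y
  have "S k \<in> borel_measurable (completion M)" for k
    unfolding S_def by measurable
  \<comment> \<open>\<open>lim\<close> of measurable functions is measurable even where the sequence
    diverges, so differentiability enters only in the almost everywhere comparison.\<close>
  then have "(\<lambda>y. infnorm (lim (\<lambda>k. S k y))) \<in> borel_measurable (completion M)"
    by (intro borel_measurable_continuous_on[OF continuous_on_infnorm] borel_measurable_lim_metric continuous_on_id)
  moreover have "AE y in M. infnorm (lim (\<lambda>k. S k y)) = zero_threshold exp id f X y"
    using ae by eventually_elim (simp only: zero_threshold_def S_def limI[OF gradient_LIMSEQ])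
  ultimately show ?thesis
    by (rule completion.measurable_AE_cong[OF _ AE_completion]) simp
qed

section \<open>The null law as a location-scale family\<close>

text \<open>Change of variables: the Jacobian \<open>a\<close> cancels the factor
  \<open>1 / a\<close> of the scaled density.\<close>

lemma density_response_density:
  assumes [measurable]: "f \<in> borel_measurable borel" and a: "0 < a"
  shows "density lborel (\<lambda>u. ennreal (response_density f b a u)) =
    distr (density lborel (\<lambda>u. ennreal (f u))) borel (\<lambda>u. b + a * u)"
proof -
  have [measurable]: "response_density f b a \<in> borel_measurable borel"
    unfolding response_density_def by measurable
  have "density lborel (\<lambda>u. ennreal (response_density f b a u)) =
      density (distr lborel borel (\<lambda>u. b + a * u)) (\<lambda>u. ennreal \<bar>a\<bar> * ennreal (response_density f b a u))"
    using a by (subst lborel_real_affine[of a b]) (simp_all add: density_density_eq)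
  also have "\<dots> = distr (density lborel (\<lambda>u. ennreal \<bar>a\<bar> * ennreal (response_density f b a (b + a * u)))) borel (\<lambda>u. b + a * u)"
    by (subst density_distr) auto
  also have "(\<lambda>u. ennreal \<bar>a\<bar> * ennreal (response_density f b a (b + a * u))) = (\<lambda>u. ennreal (f u))"
    using a by (auto simp: response_density_def simp flip: ennreal_mult')
  finally show ?thesis .
qed

lemma prob_space_density:
  assumes "(\<integral>\<^sup>+u. ennreal (f u) \<partial>lborel) = 1" "f \<in> borel_measurable borel"
  shows "prob_space (density lborel (\<lambda>u. ennreal (f u)))"
  using assms by (intro prob_spaceI) (simp add: emeasure_density)

lemma null_law_eq:
  "null_law id f X b a = distr (\<Pi>\<^sub>M i\<in>UNIV. density lborel (\<lambda>u. ennreal (response_density f b a u)))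
     borel (\<lambda>\<omega>. \<chi> i. \<omega> i)"
  by (simp add: response_law_def location_def linear_predictor_def)

lemma measurable_vec_lambda_PiM:
  assumes "\<And>i. sets (N i) = sets borel"
  shows "(\<lambda>\<omega>. (\<chi> i. \<omega> i) :: real^'n) \<in> borel_measurable (\<Pi>\<^sub>M i\<in>UNIV. N i)"
proof (rule borel_measurable_vec_lambda)
  fix i :: 'n
  have "(\<lambda>\<omega>. \<omega> i) \<in> measurable (\<Pi>\<^sub>M i\<in>UNIV. N i) (N i)"
    by (rule measurable_component_singleton) simp
  then show "(\<lambda>\<omega>. \<omega> i) \<in> borel_measurable (\<Pi>\<^sub>M i\<in>UNIV. N i)"
    using measurable_cong_sets[OF refl assms] by blast
qed

lemma borel_measurable_affine_map: "affine_map b a \<in> borel_measurable borel"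
  unfolding affine_map_def by (intro borel_measurable_vec_lambda) measurable

text \<open>A product of image measures is the image of the product under the coordinatewise map;
  passing from functions to vectors turns that map into \<open>affine_map b a\<close>.\<close>

lemma null_law_affine_map:
  fixes X :: "real^'p^'n"
  assumes f: "f \<in> borel_measurable borel" and dens: "(\<integral>\<^sup>+u. ennreal (f u) \<partial>lborel) = 1" and a: "0 < a"
  shows "null_law id f X b a = distr (null_law id f X 0 1) borel (affine_map b a)"
proof -
  define N where "N = density lborel (\<lambda>u. ennreal (f u))"
  have N: "prob_space N" "sets N = sets borel"
    using prob_space_density[OF dens f] by (simp_all add: N_def)
  have aff': "(\<lambda>u. b + a * u) \<in> measurable N borel"
    unfolding measurable_cong_sets[OF N(2) refl] by measurable
  have eq1: "density lborel (\<lambda>u. ennreal (response_density f 0 1 u)) = N"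
    by (simp add: N_def response_density_def)
  define N' where "N' = distr N borel (\<lambda>u. b + a * u)"
  have aff: "(\<lambda>u. b + a * u) \<in> measurable N N'" and N': "prob_space N'" "sets N' = sets borel"
    and eq: "density lborel (\<lambda>u. ennreal (response_density f b a u)) = N'"
    using aff' prob_space.prob_space_distr[OF N(1) aff'] density_response_density[OF f a, of b]
    by (simp_all add: N'_def N_def)
  \<comment> \<open>The product rule for images takes \<open>N'\<close> itself as target space;
    since its sets are the Borel sets, the image measure is the same.\<close>
  have N'_distr: "distr N N' (\<lambda>u. b + a * u) = N'"
    using N'(2) by (simp add: N'_def cong: distr_cong)
  let ?c = "compose (UNIV::'n set) (\<lambda>u. b + a * u)"
  have "distr (\<Pi>\<^sub>M i\<in>UNIV. N) (\<Pi>\<^sub>M i\<in>UNIV. N') ?c = (\<Pi>\<^sub>M i\<in>UNIV. distr N N' (\<lambda>u. b + a * u))"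
    by (rule distr_PiM_finite_prob_space[OF finite _ _ aff])
      (use N(1) N'(1) in \<open>auto intro: product_prob_spaceI\<close>)
  then have PiM_eq: "distr (\<Pi>\<^sub>M i\<in>UNIV. N) (\<Pi>\<^sub>M i\<in>UNIV. N') ?c = (\<Pi>\<^sub>M i\<in>UNIV. N')"
    unfolding N'_distr .
  have comp: "?c \<in> measurable (\<Pi>\<^sub>M i\<in>UNIV. N) (\<Pi>\<^sub>M i\<in>UNIV. N')"
    unfolding compose_def
    by (intro measurable_restrict measurable_compose[OF measurable_component_singleton] aff) simp
  have "null_law id f X b a = distr (\<Pi>\<^sub>M i\<in>(UNIV::'n set). N') borel (\<lambda>\<omega>. \<chi> i. \<omega> i)"
    unfolding null_law_eq eq ..
  also have "\<dots> = distr (distr (\<Pi>\<^sub>M i\<in>UNIV. N) (\<Pi>\<^sub>M i\<in>UNIV. N') ?c) borel (\<lambda>\<omega>. \<chi> i. \<omega> i)"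
    unfolding PiM_eq ..
  also have "\<dots> = distr (\<Pi>\<^sub>M i\<in>(UNIV::'n set). N) borel ((\<lambda>\<omega>. \<chi> i. \<omega> i) \<circ> ?c)"
    by (rule distr_distr[OF measurable_vec_lambda_PiM comp]) (rule N'(2))
  also have "(\<lambda>\<omega>. (\<chi> i. \<omega> i) :: real^'n) \<circ> compose UNIV (\<lambda>u. b + a * u) = affine_map b a \<circ> (\<lambda>\<omega>. \<chi> i. \<omega> i)"
    by (auto simp: compose_def affine_map_def fun_eq_iff)
  also have "distr (\<Pi>\<^sub>M i\<in>(UNIV::'n set). N) borel (affine_map b a \<circ> (\<lambda>\<omega>. \<chi> i. \<omega> i)) =
      distr (distr (\<Pi>\<^sub>M i\<in>UNIV. N) borel (\<lambda>\<omega>. \<chi> i. \<omega> i)) borel (affine_map b a)"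
    by (rule distr_distr[symmetric, OF borel_measurable_affine_map measurable_vec_lambda_PiM]) (rule N)
  also have "distr (\<Pi>\<^sub>M i\<in>(UNIV::'n set). N) borel (\<lambda>\<omega>. \<chi> i. \<omega> i) = null_law id f X 0 1"
    unfolding null_law_eq eq1 ..
  finally show ?thesis .
qed

lemma prob_space_null_law_0_1:
  assumes "f \<in> borel_measurable borel" "(\<integral>\<^sup>+u. ennreal (f u) \<partial>lborel) = 1"
  shows "prob_space (null_law id f X 0 1)"
proof -
  have "prob_space (density lborel (\<lambda>u. ennreal (response_density f 0 1 u)))"
    using prob_space_density[OF assms(2,1)] by (simp add: response_density_def)
  then show ?thesis
    unfolding null_law_eq
    by (intro prob_space.prob_space_distr prob_space_PiM measurable_vec_lambda_PiM) simp_all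
qed

lemma prob_space_null_law:
  assumes "f \<in> borel_measurable borel" "(\<integral>\<^sup>+u. ennreal (f u) \<partial>lborel) = 1" "0 < a"
  shows "prob_space (null_law id f X b a)"
  unfolding null_law_affine_map[OF assms]
  by (intro prob_space.prob_space_distr prob_space_null_law_0_1 assms)
    (simp add: response_law_def borel_measurable_affine_map)

text \<open>Replaces a statistic measurable only for the completion by a Borel representative, to
  which the ordinary calculus of image measures applies.\<close>

lemma distr_completion_AE_cong:
  assumes g: "g \<in> borel_measurable (completion M)" and h: "h \<in> borel_measurable M"
    and ae: "AE x in M. g x = h x"
  shows "distr (completion M) borel g = distr M borel h"
proof -
  have "distr (completion M) borel g = distr (completion M) borel h"
    by (rule distr_cong_AE[OF refl refl AE_completion[OF ae] g measurable_completion[OF h]])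
  then show ?thesis
    using h by (simp add: distr_completion)
qed

theorem theorem7:
  fixes X :: "real^'p^'n" and f :: "real \<Rightarrow> real"
  assumes f_measurable: "f \<in> borel_measurable borel"
    and f_pos: "\<And>u. 0 < f u"
    and f_density: "(\<integral>\<^sup>+u. ennreal (f u) \<partial>lborel) = 1"
    and mle_exists: "\<And>\<beta>0 \<sigma>. 0 < \<sigma> \<Longrightarrow>
          AE y in null_law id f X \<beta>0 \<sigma>.
            (\<exists>!\<tau>. is_null_mle f y \<tau>) \<and> (\<exists>\<tau>. is_nuisance_est id f y \<tau>)"
    and hessian: "\<And>\<beta>0 \<sigma>. 0 < \<sigma> \<Longrightarrow>
          AE y in null_law id f X \<beta>0 \<sigma>. pos_def_Hessian_at (null_nll f y) (null_mle f y)"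
    and gradient_exists: "\<And>\<beta>0 \<sigma>. 0 < \<sigma> \<Longrightarrow>
          AE y in null_law id f X \<beta>0 \<sigma>. null_profile_loss exp id f X y differentiable (at 0)"
  shows "finite_sample_pivotal exp id f X"
proof -
  let ?\<Lambda> = "zero_threshold exp id f X" and ?P = "null_law id f X"
  have sets_P: "sets (?P b a) = sets borel" for b a
    by (simp add: response_law_def)
  have meas: "?\<Lambda> \<in> borel_measurable (completion (?P b a))" if a: "0 < a" for b a
  proof (rule borel_measurable_zero_threshold[OF f_measurable sets_P _ gradient_exists[OF a]])
    have "AE y in ?P b a. (\<exists>!\<tau>. is_null_mle f y \<tau>) \<and> isCont (null_nll f y) (null_mle f y)"
      using mle_exists[OF a] hessian[OF a] by eventually_elim (auto intro: pos_def_Hessian_at_imp_isCont)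
    moreover have "finite_measure (?P b a)"
      using prob_space_null_law[OF f_measurable f_density a] by (rule prob_space.axioms)
    ultimately show "null_mle f \<in> borel_measurable (completion (?P b a))"
      using sets_P f_measurable by (intro borel_measurable_null_mle)
  qed
  \<comment> \<open>The law at parameters \<open>(0, 1)\<close> serves as the common law
    \<open>Q\<close>.\<close>
  have "distr (completion (?P b a)) borel ?\<Lambda> = distr (completion (?P 0 1)) borel ?\<Lambda>" if a: "0 < a" for b a
  proof -
    have aff: "affine_map b a \<in> measurable (?P 0 1) borel"
      unfolding measurable_cong_sets[OF sets_P refl] by (rule borel_measurable_affine_map)
    have P_eq: "?P b a = distr (?P 0 1) borel (affine_map b a)"
      by (rule null_law_affine_map[OF f_measurable f_density a])
    \<comment> \<open>\<open>?\<Lambda>\<close> need not be Borel, so composition with the affine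
      map goes through a Borel version \<open>g\<close> under \<open>?P b a\<close>; its exceptional
      set pulls back to a null set of \<open>?P 0 1\<close>.\<close>
    obtain g where g: "g \<in> borel_measurable (?P b a)" "AE y in ?P b a. ?\<Lambda> y = g y"
      using completion_ex_borel_measurable_real[OF meas[OF a]] by blast
    have g': "g \<in> borel_measurable borel"
      using g(1) unfolding measurable_cong_sets[OF sets_P refl] .
    have "AE y in ?P 0 1. ?\<Lambda> (affine_map b a y) = g (affine_map b a y)"
      using g(2) unfolding P_eq by (rule AE_distrD[OF aff])
    \<comment> \<open>Invariance enters here: almost surely under \<open>?P 0 1\<close>, the
      threshold takes the same value at \<open>y\<close> and at its affine image.\<close>
    then have "AE y in ?P 0 1. ?\<Lambda> y = (g \<circ> affine_map b a) y"
      using mle_exists[OF zero_less_one] gradient_exists[OF zero_less_one]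
    proof eventually_elim
      case (elim y)
      then show ?case
        using zero_threshold_affine_map[OF a, of f y X b] by simp
    qed
    then have "distr (completion (?P 0 1)) borel ?\<Lambda> = distr (?P 0 1) borel (g \<circ> affine_map b a)"
      by (intro distr_completion_AE_cong meas measurable_comp[OF aff g']) auto
    also have "\<dots> = distr (?P b a) borel g"
      unfolding P_eq by (rule distr_distr[OF g' aff, symmetric])
    also have "\<dots> = distr (completion (?P b a)) borel ?\<Lambda>"
      by (rule distr_completion_AE_cong[OF meas[OF a] g, symmetric])
    finally show ?thesis ..
  qed
  with meas show ?thesis
    unfolding finite_sample_pivotal_def by blast
qed

end
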